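(* Let $a\geq 1$ and $d\geq 4$ be integers with $a<\frac{d+3}{2}$ and $\gcd(a,d+3)=1$. Then \[ \lim_{n\to\infty} \Delta_d^{(a,-,-)}(n) = +\infty, \qquad\text{where } \Delta_d^{(a,-,-)}(n) := q_d^{(a)}(n) - Q_d^{(a,-,-)}(n). \]
   Context: For positive integers $a,d,n$, $q_d^{(a)}(n)$ denotes the number of partitions of $n$ in which every part is at least $a$ and any two parts differ by at least $d$. For $1\le b\le d+2$, $Q_d^{(b,-,-)}(n)$ denotes the number of partitions of $n$ into parts congruent to $\pm b \pmod{d+3}$, where the parts $b$ and $d+3-b$ are not allowed. *)

theory Defs
  imports Complex_Main "HOL-Library.Multiset" "HOL-Number_Theory.Cong"
begin

definition partitions_of :: "nat \<Rightarrow> nat multiset set" where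
  "partitions_of n = {M. (\<forall>p\<in>#M. 0 < p) \<and> \<Sum>\<^sub># M = n}"

text \<open>
  Two parts are two occurrences in the multiset: the submultiset condition with \<open>x = y\<close>
  says that \<open>x\<close> occurs at least twice, so for \<open>d > 0\<close> repeated parts are excluded.
\<close>

definition parts_differ_by_at_least :: "nat \<Rightarrow> nat multiset \<Rightarrow> bool" where
  "parts_differ_by_at_least d M \<longleftrightarrow>
     (\<forall>x y. {#x, y#} \<subseteq># M \<longrightarrow> int d \<le> \<bar>int x - int y\<bar>)"

definition q :: "nat \<Rightarrow> nat \<Rightarrow> nat \<Rightarrow> nat" where
  "q d a n = card {M \<in> partitions_of n. (\<forall>p\<in>#M. a \<le> p) \<and> parts_differ_by_at_least d M}"

text \<open>\<open>Q_minus_minus d b n\<close> is $Q_d^{(b,-,-)}(n)$, intended for $1 \le b \le d+2$.\<close>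

definition Q_minus_minus :: "nat \<Rightarrow> nat \<Rightarrow> nat \<Rightarrow> nat" where
  "Q_minus_minus d b n = card {M \<in> partitions_of n.
     \<forall>p\<in>#M. ([int p = int b] (mod int (d + 3)) \<or> [int p = - int b] (mod int (d + 3)))
       \<and> p \<noteq> b \<and> p \<noteq> d + 3 - b}"

definition Delta_minus_minus :: "nat \<Rightarrow> nat \<Rightarrow> nat \<Rightarrow> int" where
  "Delta_minus_minus d a n = int (q d a n) - int (Q_minus_minus d a n)"

end

theory Submission
  imports Defs "HOL-Combinatorics.Multiset_Permutations" "HOL-Analysis.Gamma_Function"
    "HOL-Real_Asymp.Real_Asymp"
begin

text \<open>
  Both counting functions grow like \<open>exp (c \<surd>n)\<close>, and elementary bounds already separate the two
  exponents. With \<open>m = d + 3\<close>, every part counted by $Q_d^{(a,-,-)}$ exceeds \<open>m\<close>, and at most two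
  admissible parts lie in each block \<open>{mj, ..., mj + m - 1}\<close>. Evaluating the generating product at
  \<open>exp (-t)\<close> therefore gives \<open>Q(n) \<le> exp (nt + \<pi>\<^sup>2/(3mt))\<close>, and the best \<open>t\<close> yields the exponent
  \<open>2\<pi>/\<surd>(3m)\<close>.

  For \<open>q\<close>, adding the staircase \<open>a, a + d, a + 2d, ...\<close> to a partition of \<open>N\<close> into \<open>k\<close> parts
  (zeros allowed) produces a partition with gaps at least \<open>d\<close>, so
  \<open>q(n) \<ge> N^(k-1) / k!\<^sup>2\<close> where \<open>N = n - ak - dk(k-1)/2\<close>. Taking \<open>k \<sim> \<kappa> \<surd>n\<close> with \<open>\<kappa>\<^sup>2 = 3/(4d)\<close>
  yields any exponent below \<open>\<kappa> (2 + ln (5d/6))\<close>, which is larger than \<open>2\<pi>/\<surd>(3m)\<close> as soon as \<open>d \<ge> 4\<close>.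
\<close>

section \<open>Counting partitions by their generating product\<close>

definition partitions_with_parts_in :: "nat set \<Rightarrow> nat \<Rightarrow> nat multiset set" where
  "partitions_with_parts_in S n = {M. set_mset M \<subseteq> S \<and> \<Sum>\<^sub># M = n}"

lemma finite_partitions_of: "finite (partitions_of n)"
proof (rule finite_subset)
  show "partitions_of n \<subseteq> mset ` {xs. set xs \<subseteq> {..n} \<and> length xs \<le> n}"
  proof
    fix M assume M: "M \<in> partitions_of n"
    obtain xs where xs: "mset xs = M" using ex_mset by blast
    have sum: "sum_list xs = n" and pos: "\<forall>p\<in>set xs. 0 < p"
      using M xs by (auto simp: partitions_of_def simp flip: sum_mset_sum_list)
    have "length xs \<le> sum_list xs"
      using pos by (induction xs) auto
    moreover have "set xs \<subseteq> {..n}"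
      using sum member_le_sum_list by auto
    ultimately show "M \<in> mset ` {xs. set xs \<subseteq> {..n} \<and> length xs \<le> n}"
      using sum xs by blast
  qed
qed (simp add: finite_lists_length_le)

lemma finite_partitions_with_parts_in:
  assumes "0 \<notin> S"
  shows "finite (partitions_with_parts_in S n)"
  by (rule finite_subset[OF _ finite_partitions_of[of n]])
     (use assms in \<open>auto simp: partitions_of_def partitions_with_parts_in_def intro!: gr0I\<close>)

text \<open>Either \<open>p\<close> does not occur or one copy of it can be removed. The rest may
  contain \<open>p\<close> again, and this recursion produces the factor
  \<open>1 / (1 - x ^ p)\<close>.\<close>

lemma partitions_with_parts_in_insert:
  "partitions_with_parts_in (insert p S) n \<subseteq> partitions_with_parts_in S n \<union>
     (if p \<le> n then add_mset p ` partitions_with_parts_in (insert p S) (n - p) else {})"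
proof
  fix M assume M: "M \<in> partitions_with_parts_in (insert p S) n"
  show "M \<in> partitions_with_parts_in S n \<union>
     (if p \<le> n then add_mset p ` partitions_with_parts_in (insert p S) (n - p) else {})"
  proof (cases "p \<in># M")
    case True
    then obtain N where N: "M = add_mset p N" by (meson mset_add)
    then have "p \<le> n" "N \<in> partitions_with_parts_in (insert p S) (n - p)"
      using M by (auto simp: partitions_with_parts_in_def)
    then show ?thesis using N by simp
  next
    case False
    then show ?thesis using M by (auto simp: partitions_with_parts_in_def)
  qed
qed

text \<open>A single term of the generating function is at most its value at \<open>x\<close>.
  Infinite products are avoided by induction on \<open>S\<close> and, for each new part
  \<open>p\<close>, on \<open>n\<close>: the bound \<open>y = ?P / (1 - x ^ p)\<close> solves
  \<open>y = ?P + y * x ^ p\<close>, which is the recursion from removing one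
  \<open>p\<close>.\<close>

lemma card_partitions_with_parts_in_le:
  fixes x :: real
  assumes "finite S" "0 \<notin> S" "0 < x" "x < 1"
  shows "real (card (partitions_with_parts_in S n)) * x ^ n \<le> (\<Prod>p\<in>S. 1 / (1 - x ^ p))"
  using assms(1,2)
proof (induction S arbitrary: n rule: finite_induct)
  case empty
  have "partitions_with_parts_in {} n = (if n = 0 then {{#}} else {})"
    by (auto simp: partitions_with_parts_in_def)
  then show ?case by simp
next
  case (insert p S)
  let ?P = "\<Prod>p\<in>S. 1 / (1 - x ^ p)"
  let ?c = "\<lambda>T n. real (card (partitions_with_parts_in T n))"
  have p: "p > 0" "0 \<notin> S" "0 \<notin> insert p S" using insert.prems by auto
  have xp: "0 < x ^ p" "x ^ p < 1"
    using assms p by (auto simp: power_less_one_iff)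
  have P: "?P \<ge> 0"
    using assms by (intro prod_nonneg) (auto simp: power_le_one)
  have "?c (insert p S) n * x ^ n \<le> ?P / (1 - x ^ p)"
  proof (induction n rule: less_induct)
    case (less n)
    show ?case
    proof (cases "p \<le> n")
      case True
      let ?A = "partitions_with_parts_in S n"
      let ?B = "partitions_with_parts_in (insert p S) (n - p)"
      have fin: "finite ?A" "finite ?B"
        using p finite_partitions_with_parts_in by auto
      have "card (partitions_with_parts_in (insert p S) n) \<le> card (?A \<union> add_mset p ` ?B)"
        using partitions_with_parts_in_insert[of p S n] True fin by (intro card_mono) auto
      also have "\<dots> \<le> card ?A + card (add_mset p ` ?B)"
        by (rule card_Un_le)
      also have "\<dots> \<le> card ?A + card ?B"
        using card_image_le[OF fin(2)] by auto
      finally have "?c (insert p S) n \<le> ?c S n + ?c (insert p S) (n - p)" by linarith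
      then have "?c (insert p S) n * x ^ n \<le> (?c S n + ?c (insert p S) (n - p)) * x ^ n"
        using assms by (intro mult_right_mono) auto
      also have "\<dots> = ?c S n * x ^ n + ?c (insert p S) (n - p) * x ^ (n - p) * x ^ p"
        using True by (simp add: algebra_simps flip: power_add)
      also have "\<dots> \<le> ?P + ?P / (1 - x ^ p) * x ^ p"
        using insert.IH[OF p(2), of n] less.IH[of "n - p"] p True xp
        by (intro add_mono mult_right_mono) auto
      also have "\<dots> = ?P / (1 - x ^ p)"
        using xp by (simp add: field_simps)
      finally show ?thesis .
    next
      case False
      then have "partitions_with_parts_in (insert p S) n \<subseteq> partitions_with_parts_in S n"
        using partitions_with_parts_in_insert[of p S n] by simp
      then have "?c (insert p S) n \<le> ?c S n"
        using finite_partitions_with_parts_in[OF p(2)] by (simp add: card_mono)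
      then have "?c (insert p S) n * x ^ n \<le> ?c S n * x ^ n"
        using assms by (intro mult_right_mono) auto
      also have "\<dots> \<le> ?P" using insert.IH[OF p(2)] .
      also have "\<dots> \<le> ?P / (1 - x ^ p)"
        using P xp by (simp add: field_simps)
      finally show ?thesis .
    qed
  qed
  then show ?case using insert.hyps by simp
qed

section \<open>Upper bound for the excluded-parts count \<open>Q_minus_minus\<close>\<close>

text \<open>The full geometric series equals \<open>1 / (exp u - 1)\<close>, and
  \<open>exp u >= 1 + u\<close>.\<close>

lemma sum_exp_le:
  fixes u :: real
  assumes "u > 0"
  shows "(\<Sum>j=1..n. exp (- u) ^ j) \<le> 1 / u"
proof -
  let ?z = "exp (- u)"
  have "(\<Sum>j=1..n. z ^ j) * (1 - z) = z - z ^ Suc n" for z :: real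
  proof (induction n)
    case (Suc n)
    have "(\<Sum>j=1..Suc n. z ^ j) * (1 - z) = (\<Sum>j=1..n. z ^ j) * (1 - z) + z ^ Suc n * (1 - z)"
      by (simp add: distrib_right)
    also have "\<dots> = z - z ^ Suc (Suc n)"
      unfolding Suc.IH by (simp add: algebra_simps)
    finally show ?case .
  qed simp
  then have "(\<Sum>j=1..n. ?z ^ j) * (1 - ?z) = ?z - ?z ^ Suc n" .
  also have "\<dots> \<le> ?z" by simp
  finally have "(\<Sum>j=1..n. ?z ^ j) * (1 - ?z) \<le> ?z" .
  then have le: "(\<Sum>j=1..n. ?z ^ j) \<le> ?z / (1 - ?z)"
    using assms by (simp add: pos_le_divide_eq)
  have "?z * (1 + u) \<le> ?z * exp u"
    by (intro mult_left_mono) auto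
  then have "?z * u \<le> 1 - ?z"
    by (simp add: algebra_simps flip: exp_add)
  then have "?z / (1 - ?z) \<le> 1 / u"
    using assms by (simp add: field_simps)
  then show ?thesis using le by linarith
qed

text \<open>Expand each logarithm into its power series and exchange the sums. The terms of degree
  \<open>k\<close> form a geometric sum of at most \<open>1 / (k * s)\<close>; dividing by
  \<open>k\<close> and summing over \<open>k\<close> leaves the Basel series.\<close>

lemma sum_neg_ln_one_minus_exp_le:
  fixes s :: real
  assumes "s > 0"
  shows "(\<Sum>j=1..n. - ln (1 - exp (- s) ^ j)) \<le> pi\<^sup>2 / (6 * s)"
proof -
  let ?y = "exp (- s)"
  have "(\<lambda>k. (?y ^ j) ^ k / real k) sums (- ln (1 - ?y ^ j))" if "j \<in> {1..n}" for j
  proof -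
    have "?y ^ j < 1"
      using assms that by (auto simp: power_less_one_iff)
    then have "(\<lambda>k. - ((- (- (?y ^ j))) ^ k) / real k) sums ln (1 + - (?y ^ j))"
      by (intro ln_series') auto
    from sums_minus[OF this] show ?thesis by simp
  qed
  then have "(\<lambda>k. \<Sum>j=1..n. (?y ^ j) ^ k / real k) sums (\<Sum>j=1..n. - ln (1 - ?y ^ j))"
    by (rule sums_sum)
  \<comment> \<open>The term at \<open>k = 0\<close> is a division by zero, hence \<open>0\<close>,
    so the series may start at \<open>k = 1\<close>.\<close>
  then have 1: "(\<lambda>k. \<Sum>j=1..n. (?y ^ j) ^ Suc k / real (Suc k))
      sums (\<Sum>j=1..n. - ln (1 - ?y ^ j))"
    by (subst sums_Suc_iff) simp
  have 2: "(\<lambda>k. 1 / s * (1 / (real k + 1)\<^sup>2)) sums (1 / s * (pi\<^sup>2 / 6))"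
    using inverse_squares_sums by (intro sums_mult) (simp add: add.commute)
  have "(\<Sum>j=1..n. (?y ^ j) ^ Suc k / real (Suc k)) \<le> 1 / s * (1 / (real k + 1)\<^sup>2)" for k
  proof -
    have "(\<Sum>j=1..n. (?y ^ j) ^ Suc k / real (Suc k))
        = (\<Sum>j=1..n. exp (- (real (Suc k) * s)) ^ j) / real (Suc k)"
      unfolding sum_divide_distrib
      by (intro sum.cong refl arg_cong2[where f = "(/)"])
         (simp only: exp_of_nat_mult[symmetric], simp add: algebra_simps)
    also have "\<dots> \<le> 1 / (real (Suc k) * s) / real (Suc k)"
      using assms by (intro divide_right_mono sum_exp_le) auto
    also have "\<dots> = 1 / s * (1 / (real k + 1)\<^sup>2)"
      by (simp add: power2_eq_square add.commute)
    finally show ?thesis .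
  qed
  from sums_le[OF this 1 2] show ?thesis by (simp add: mult.commute)
qed

lemma Q_minus_minus_le:
  fixes t :: real
  assumes "0 < a" "a < d + 3" "t > 0"
  shows "real (Q_minus_minus d a n) \<le> exp (real n * t + pi\<^sup>2 / (3 * real (d + 3) * t))"
proof -
  define m where "m = d + 3"
  \<comment> \<open>The index starts at \<open>1\<close> because \<open>j = 0\<close> would give the
    forbidden parts \<open>a\<close> and \<open>m - a\<close>; stopping at \<open>n\<close> keeps
    the sets finite and still reaches every part up to \<open>n\<close>.\<close>
  define A where "A = (\<lambda>j. m * j + a) ` {1..n}"
  define B where "B = (\<lambda>j. m * j + (m - a)) ` {1..n}"
  define x where "x = exp (- t)"
  have m: "m > 0" "a < m" using assms by (auto simp: m_def)
  have x: "0 < x" "x < 1" using assms by (auto simp: x_def)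
  have fin: "finite A" "finite B" "0 \<notin> A \<union> B"
    using assms by (auto simp: A_def B_def m_def)
  have part: "p \<in> A \<union> B"
    if p: "[int p = int a] (mod int m) \<or> [int p = - int a] (mod int m)"
      "p \<noteq> a" "p \<noteq> m - a" "p \<le> n" for p
  proof -
    have *: "p \<in> (\<lambda>j. m * j + b) ` {1..n}"
      if "b < m" "[int p = int b] (mod int m)" "p \<noteq> b" for b
    proof -
      have "p mod m = b"
        using that by (auto simp: unique_euclidean_semiring_class.cong_def simp flip: of_nat_mod)
      then have eq: "p = m * (p div m) + b" by (metis mult_div_mod_eq)
      then have "p div m \<noteq> 0" using that(3) by (metis add_0 mult_0_right)
      moreover have "p div m \<le> n" using p(4) by (meson div_le_dividend le_trans)
      ultimately show ?thesis using eq by auto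
    qed
    from p(1) show ?thesis
    proof
      assume "[int p = int a] (mod int m)"
      then show ?thesis using * m p by (auto simp: A_def)
    next
      assume "[int p = - int a] (mod int m)"
      then have "[int p = int (m - a)] (mod int m)"
        using m by (simp add: of_nat_diff unique_euclidean_semiring_class.cong_def)
      then show ?thesis using *[of "m - a"] m assms p by (auto simp: B_def)
    qed
  qed
  have "Q_minus_minus d a n \<le> card (partitions_with_parts_in (A \<union> B) n)"
    unfolding Q_minus_minus_def
  proof (rule card_mono[OF finite_partitions_with_parts_in[OF fin(3)]], safe)
    fix M assume M: "M \<in> partitions_of n"
      and c: "\<forall>p\<in>#M. ([int p = int a] (mod int (d + 3)) \<or> [int p = - int a] (mod int (d + 3)))
       \<and> p \<noteq> a \<and> p \<noteq> d + 3 - a"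
    have "p \<in> A \<union> B" if "p \<in># M" for p
    proof (rule part)
      show "p \<le> n"
        using multi_member_split[OF that] M by (auto simp: partitions_of_def)
    qed (use c that in \<open>simp_all add: m_def\<close>)
    then show "M \<in> partitions_with_parts_in (A \<union> B) n"
      using M by (auto simp: partitions_of_def partitions_with_parts_in_def)
  qed
  then have "real (Q_minus_minus d a n) * x ^ n
      \<le> real (card (partitions_with_parts_in (A \<union> B) n)) * x ^ n"
    using x by simp
  also have "\<dots> \<le> (\<Prod>p\<in>A \<union> B. 1 / (1 - x ^ p))"
    using fin x by (intro card_partitions_with_parts_in_le) auto
  also have "\<dots> = exp (\<Sum>p\<in>A \<union> B. - ln (1 - x ^ p))"
  proof -
    have "exp (- ln (1 - x ^ p)) = 1 / (1 - x ^ p)" if "p \<in> A \<union> B" for p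
    proof -
      have "p > 0" using that fin by (metis gr0I)
      then have "x ^ p < 1" using x by (simp add: power_less_one_iff)
      then show ?thesis by (simp add: exp_minus inverse_eq_divide)
    qed
    then show ?thesis using fin by (simp add: exp_sum)
  qed
  also have "\<dots> \<le> exp (pi\<^sup>2 / (3 * real m * t))"
  proof -
    have block: "(\<Sum>p\<in>(\<lambda>j. m * j + b) ` {1..n}. - ln (1 - x ^ p)) \<le> pi\<^sup>2 / (6 * (real m * t))" for b
    proof -
      have "inj_on (\<lambda>j. m * j + b) {1..n}" using m by (auto intro!: inj_onI)
      then have "(\<Sum>p\<in>(\<lambda>j. m * j + b) ` {1..n}. - ln (1 - x ^ p))
          = (\<Sum>j=1..n. - ln (1 - x ^ (m * j + b)))"
        by (simp add: sum.reindex)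
      also have "\<dots> \<le> (\<Sum>j=1..n. - ln (1 - exp (- (real m * t)) ^ j))"
      proof (rule sum_mono)
        fix j assume j: "j \<in> {1..n}"
        have eq: "exp (- (real m * t)) ^ j = x ^ (m * j)"
          by (simp add: x_def mult_ac flip: exp_of_nat_mult)
        have "x ^ (m * j + b) \<le> x ^ (m * j)"
          using x by (intro power_decreasing) auto
        moreover have "x ^ (m * j) < 1"
          using x m j by (simp add: power_less_one_iff)
        ultimately show "- ln (1 - x ^ (m * j + b)) \<le> - ln (1 - exp (- (real m * t)) ^ j)"
          unfolding eq by simp
      qed
      also have "\<dots> \<le> pi\<^sup>2 / (6 * (real m * t))"
        using m assms by (intro sum_neg_ln_one_minus_exp_le) auto
      finally show ?thesis .
    qed
    have nonneg: "0 \<le> - ln (1 - x ^ p)" if "p \<in> A \<union> B" for p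
    proof -
      have "p > 0" using that fin by (metis gr0I)
      then have "x ^ p < 1" using x by (simp add: power_less_one_iff)
      then show ?thesis using x by simp
    qed
    \<comment> \<open>\<open>A\<close> and \<open>B\<close> coincide when \<open>2 * a = m\<close>,
      so the sum over the union is only bounded by the two separate sums.\<close>
    have "(\<Sum>p\<in>A \<union> B. - ln (1 - x ^ p)) 
        = (\<Sum>p\<in>A. - ln (1 - x ^ p)) + (\<Sum>p\<in>B. - ln (1 - x ^ p)) - (\<Sum>p\<in>A \<inter> B. - ln (1 - x ^ p))"
      using fin by (intro sum_Un) auto
    also have "\<dots> \<le> (\<Sum>p\<in>A. - ln (1 - x ^ p)) + (\<Sum>p\<in>B. - ln (1 - x ^ p))"
      using sum_nonneg[of "A \<inter> B" "\<lambda>p. - ln (1 - x ^ p)"] nonneg by auto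
    also have "\<dots> \<le> pi\<^sup>2 / (6 * (real m * t)) + pi\<^sup>2 / (6 * (real m * t))"
      unfolding A_def B_def by (intro add_mono block)
    also have "\<dots> = pi\<^sup>2 / (3 * real m * t)" by (simp add: field_simps)
    finally show ?thesis by simp
  qed
  finally have le: "real (Q_minus_minus d a n) * x ^ n \<le> exp (pi\<^sup>2 / (3 * real m * t))" .
  have "x ^ n * exp (real n * t) = 1"
    by (simp add: x_def flip: exp_of_nat_mult exp_add)
  then have "real (Q_minus_minus d a n) = real (Q_minus_minus d a n) * x ^ n * exp (real n * t)"
    by (simp add: mult.assoc)
  also have "\<dots> \<le> exp (pi\<^sup>2 / (3 * real m * t)) * exp (real n * t)"
    using le by (intro mult_right_mono) auto
  finally show ?thesis by (simp add: m_def add.commute flip: exp_add)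
qed

section \<open>Lower bound for \<open>q\<close> by adding staircases to sorted lists\<close>

lemma parts_differ_by_at_least_mset:
  assumes "sorted_wrt (\<lambda>x y. x + d \<le> y) xs"
  shows "parts_differ_by_at_least d (mset xs)"
  using assms
proof (induction xs)
  case Nil
  then show ?case by (simp add: parts_differ_by_at_least_def)
next
  case (Cons z xs)
  show ?case
    unfolding parts_differ_by_at_least_def
  proof (intro allI impI)
    fix x y assume sub: "{#x, y#} \<subseteq># mset (z # xs)"
    have gap: "z + d \<le> w" if "w \<in># mset xs" for w
      using Cons.prems that by simp
    consider "x = z" | "y = z" | "x \<noteq> z" "y \<noteq> z" by blast
    then show "int d \<le> \<bar>int x - int y\<bar>"
    proof cases
      \<comment> \<open>Cancelling one copy of \<open>z\<close> leaves the other entry in the tail,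
        even when both entries equal \<open>z\<close>.\<close>
      case 1
      then have "y \<in># mset xs" using sub by simp
      then show ?thesis using gap[of y] 1 by linarith
    next
      case 2
      then have "x \<in># mset xs" using sub by (simp add: add_mset_commute[of x])
      then show ?thesis using gap[of x] 2 by linarith
    next
      case 3
      then have "z \<notin># {#x, y#}" by auto
      then have "{#x, y#} \<subseteq># mset xs"
        using sub by (metis diff_single_trivial mset.simps(2) add_mset_remove_trivial subset_eq_diff_conv
            add_mset_add_single)
      then show ?thesis
        using Cons by (auto simp: parts_differ_by_at_least_def)
    qed
  qed
qed

definition staircase :: "nat \<Rightarrow> nat \<Rightarrow> nat list \<Rightarrow> nat list" where
  "staircase a d xs = map (\<lambda>i. xs ! i + a + d * i) [0..<length xs]"

lemma inj_staircase: "inj (staircase a d)"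
proof (rule injI, rule nth_equalityI)
  fix xs ys assume eq: "staircase a d xs = staircase a d ys"
  then show len: "length xs = length ys"
    by (metis staircase_def length_map length_upt minus_nat.diff_0)
  fix i assume "i < length xs"
  then show "xs ! i = ys ! i"
    using arg_cong[OF eq, of "\<lambda>zs. zs ! i"] len by (simp add: staircase_def)
qed

lemma sum_list_staircase:
  "sum_list (staircase a d xs)
     = sum_list xs + a * length xs + d * (length xs * (length xs - 1) div 2)"
  by (simp add: staircase_def interv_sum_list_conv_sum_set_nat sum.distrib sum_list_sum_nth
      Sum_Ico_nat flip: sum_distrib_left)

lemma sorted_wrt_staircase:
  assumes "sorted xs"
  shows "sorted_wrt (\<lambda>x y. x + d \<le> y) (staircase a d xs)"
proof -
  have "xs ! i + a + d * i + d \<le> xs ! j + a + d * j" if "i < j" "j < length xs" for i j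
  proof -
    have "d * Suc i \<le> d * j" using that by (intro mult_le_mono2) auto
    then show ?thesis using sorted_nth_mono[OF assms, of i j] that by simp
  qed
  then show ?thesis
    by (simp add: staircase_def sorted_wrt_iff_nth_less)
qed

text \<open>Stars and bars counts all lists of length \<open>k\<close> with sum \<open>N\<close>;
  each rearranges a sorted one, and a sorted list has at most \<open>fact k\<close>
  rearrangements.\<close>

lemma card_sorted_lists_ge:
  "(N + k - 1) choose N \<le> card {xs :: nat list. sorted xs \<and> length xs = k \<and> sum_list xs = N} * fact k"
proof -
  let ?L = "{xs :: nat list. length xs = k \<and> sum_list xs = N}"
  let ?S = "{xs :: nat list. sorted xs \<and> length xs = k \<and> sum_list xs = N}"
  have fin: "finite ?S"
    by (rule finite_subset[OF _ finite_lists_length_eq[of "{..N}" k]])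
       (auto dest: member_le_sum_list)
  have "?L \<subseteq> (\<Union>xs\<in>?S. permutations_of_multiset (mset xs))"
  proof
    fix xs assume "xs \<in> ?L"
    moreover have "sum_list (sort xs) = sum_list xs"
      by (metis mset_sort sum_mset_sum_list)
    ultimately show "xs \<in> (\<Union>xs\<in>?S. permutations_of_multiset (mset xs))"
      by (intro UN_I[of "sort xs"]) (auto intro: permutations_of_multisetI)
  qed
  then have "card ?L \<le> card (\<Union>xs\<in>?S. permutations_of_multiset (mset xs))"
    using fin by (intro card_mono) auto
  also have "\<dots> \<le> (\<Sum>xs\<in>?S. card (permutations_of_multiset (mset xs)))"
    using fin by (rule card_UN_le)
  also have "\<dots> \<le> (\<Sum>xs\<in>?S. fact k)"
    by (intro sum_mono) (auto simp: card_permutations_of_multiset(1) div_le_dividend)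
  also have "\<dots> = card ?S * fact k" by simp
  finally show ?thesis by (simp add: card_length_sum_list)
qed

text \<open>The staircase of a sorted list is again sorted, so its multiset determines it and hence
  the original list. The argument of \<open>q\<close> is \<open>N\<close> plus the weight of the
  staircase.\<close>

lemma card_sorted_lists_le_q:
  assumes "0 < a"
  shows "card {xs :: nat list. sorted xs \<and> length xs = k \<and> sum_list xs = N}
    \<le> q d a (N + a * k + d * (k * (k - 1) div 2))"
proof -
  let ?S = "{xs :: nat list. sorted xs \<and> length xs = k \<and> sum_list xs = N}"
  let ?n = "N + a * k + d * (k * (k - 1) div 2)"
  let ?T = "{M \<in> partitions_of ?n. (\<forall>p\<in>#M. a \<le> p) \<and> parts_differ_by_at_least d M}"
  have sorted: "sorted (staircase a d xs)" if "sorted xs" for xs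
    by (rule sorted_wrt_mono_rel[OF _ sorted_wrt_staircase[OF that, of d a]]) auto
  have "inj_on (mset \<circ> staircase a d) ?S"
  proof (rule inj_onI)
    fix xs ys assume "xs \<in> ?S" "ys \<in> ?S" "(mset \<circ> staircase a d) xs = (mset \<circ> staircase a d) ys"
    then have "staircase a d xs = staircase a d ys"
      using sorted by (metis (mono_tags, lifting) comp_apply mem_Collect_eq properties_for_sort)
    then show "xs = ys" by (rule injD[OF inj_staircase])
  qed
  moreover have "(mset \<circ> staircase a d) ` ?S \<subseteq> ?T"
  proof (rule image_subsetI)
    fix xs assume xs: "xs \<in> ?S"
    have ge: "\<forall>p\<in>set (staircase a d xs). a \<le> p" by (auto simp: staircase_def)
    have "\<Sum>\<^sub># (mset (staircase a d xs)) = ?n"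
      using xs by (simp add: sum_mset_sum_list sum_list_staircase)
    then show "(mset \<circ> staircase a d) xs \<in> ?T"
      using xs ge assms parts_differ_by_at_least_mset[OF sorted_wrt_staircase, of xs d a]
      by (force simp: partitions_of_def)
  qed
  moreover have "finite ?T" using finite_partitions_of by simp
  ultimately have "card ?S \<le> card ?T" by (rule card_inj_on_le)
  then show ?thesis by (simp add: q_def)
qed

text \<open>The right-hand side is \<open>(N + 1) ... (N + j)\<close>, a product of \<open>j\<close>
  factors above \<open>N\<close>.\<close>

lemma power_le_fact_binomial: "N ^ j \<le> ((N + j) choose N) * fact j"
proof -
  have "fact N * N ^ j \<le> (fact (N + j) :: nat)"
  proof (induction j)
    case (Suc j)
    have "fact N * N ^ Suc j = N * (fact N * N ^ j)" by simp
    also have "\<dots> \<le> (N + Suc j) * fact (N + j)"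
      using Suc by (intro mult_le_mono) auto
    finally show ?case by simp
  qed simp
  also have "\<dots> = fact N * (((N + j) choose N) * fact j)"
    using binomial_fact_lemma[of N "N + j"] by (simp add: mult_ac)
  finally show ?thesis by simp
qed

text \<open>This is the staircase bound with \<open>Suc j\<close> parts. Enlarging the
  \<open>fact j\<close> from the binomial to \<open>fact (Suc j)\<close> costs a factor
  \<open>Suc j\<close>, negligible on the scale of \<open>exp (c * sqrt n)\<close>.\<close>

lemma power_le_q:
  assumes "0 < a"
  shows "N ^ j \<le> q d a (N + a * Suc j + d * (Suc j * j div 2)) * (fact (Suc j))\<^sup>2"
proof -
  let ?q = "q d a (N + a * Suc j + d * (Suc j * j div 2))"
  have "(N + j) choose N \<le> ?q * fact (Suc j)"
    using card_sorted_lists_ge[of N "Suc j"] card_sorted_lists_le_q[OF assms, of "Suc j" N d]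
    by (simp del: fact_Suc) (meson le_trans mult_le_mono1)
  then have "((N + j) choose N) * fact j \<le> ?q * fact (Suc j) * fact (Suc j)"
    by (intro mult_le_mono) (auto intro: fact_mono)
  then show ?thesis
    using power_le_fact_binomial[of N j] by (simp del: fact_Suc add: power2_eq_square mult.assoc)
qed

section \<open>Logarithm estimates and comparison of the growth constants\<close>

text \<open>A weak Stirling bound. The induction step amounts to
  \<open>(k + 1) * (ln (k + 1) - ln k) >= 1\<close>, which is \<open>ln x <= x - 1\<close> at
  \<open>x = k / (k + 1)\<close>.\<close>

lemma ln_fact_le:
  assumes "k > 0"
  shows "ln (fact k) \<le> real k * ln (real k) - real k + 1 + ln (real k)"
  using assms
proof (induction k rule: nat_induct_non_zero)
  case (Suc k)
  have "ln (real k / real (Suc k)) \<le> real k / real (Suc k) - 1"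
    using Suc.hyps by (intro ln_le_minus_one) auto
  then have "ln (real k) - ln (real (Suc k)) \<le> - 1 / real (Suc k)"
    using Suc.hyps by (simp add: ln_div field_simps)
  then have "real (Suc k) * (ln (real k) - ln (real (Suc k))) \<le> real (Suc k) * (- 1 / real (Suc k))"
    by (intro mult_left_mono) auto
  then have "real (Suc k) * ln (real k) + 1 \<le> real (Suc k) * ln (real (Suc k))"
    by (simp add: right_diff_distrib)
  moreover have "ln (fact (Suc k) :: real) = ln (real (Suc k)) + ln (fact k)"
    by (simp add: ln_mult)
  ultimately show ?case using Suc.IH by (simp add: algebra_simps)
qed simp

text \<open>This is \<open>ln x <= x - 1\<close> at \<open>x = exp r / y\<close>, with equality at
  \<open>y = exp r\<close>. Given a numerical bound on \<open>exp r\<close>, it bounds logarithms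
  below by rational numbers.\<close>

lemma ln_ge_sub_exp_divide:
  fixes y r :: real
  assumes "y > 0"
  shows "ln y \<ge> r + 1 - exp r / y"
proof -
  have "ln (exp r / y) \<le> exp r / y - 1"
    using assms by (intro ln_le_minus_one) auto
  then show ?thesis using assms by (simp add: ln_div)
qed

text \<open>Both sides are exponents of growth divided by \<open>sqrt (3 / (4 * d))\<close>. The
  left side stays below \<open>4 * pi / 3\<close> while the right side increases, so
  \<open>d >= 11\<close> is treated uniformly and the smaller values one by one.\<close>

lemma growth_constants_less:
  assumes "d \<ge> 4"
  shows "4 * pi / 3 * sqrt (real d / (real d + 3)) < 2 + ln (5 * real d / 6)"
proof -
  have e2: "exp (2::real) \<le> 74/10"
  proof -
    have "exp (2::real) = exp 1 * exp 1" by (simp flip: exp_add)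
    also have "\<dots> \<le> (272/100) * (272/100)" using e_less_272 by (intro mult_mono) auto
    finally show ?thesis by simp
  qed
  \<comment> \<open>In each case \<open>r\<close> is a decimal upper bound for
    \<open>sqrt (d / (d + 3))\<close>.\<close>
  have bound: "4 * pi / 3 * sqrt (real d / (real d + 3)) < 4.189 * r"
    if "r > 0" "real d \<le> r\<^sup>2 * (real d + 3)" for r
  proof -
    have "sqrt (real d / (real d + 3)) \<le> r"
      using that by (intro real_le_lsqrt) (auto simp: field_simps)
    moreover have "4 * pi / 3 < 4.189" using pi_approx by simp
    ultimately show ?thesis
      using that(1) assms by (intro mult_less_le_imp_less) auto
  qed
  \<comment> \<open>\<open>l1\<close> is sharp near \<open>5 * d / 6 = exp 1\<close> and serves
    \<open>d <= 6\<close>; \<open>l2\<close> is sharp near \<open>exp 2\<close> and serves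
    \<open>d >= 7\<close>.\<close>
  have l1: "ln (5 * real d / 6) \<ge> 2 - 2.72 * 6 / (5 * real d)"
    using ln_ge_sub_exp_divide[of "5 * real d / 6" 1] assms e_less_272
    by (simp add: field_simps) 
  have l2: "ln (5 * real d / 6) \<ge> 3 - 7.4 * 6 / (5 * real d)"
    using ln_ge_sub_exp_divide[of "5 * real d / 6" 2] assms e2
    by (simp add: field_simps) 
  consider "d = 4" | "d = 5" | "d = 6" | "d = 7" | "d = 8" | "d = 9" | "d = 10" | "d \<ge> 11"
    using assms by linarith
  then show ?thesis
  proof cases
    case 1 then show ?thesis using bound[of "0.7560"] l1 by (simp add: power2_eq_square)
  next
    case 2 then show ?thesis using bound[of "0.7906"] l1 by (simp add: power2_eq_square)
  next
    case 3 then show ?thesis using bound[of "0.8165"] l1 by (simp add: power2_eq_square)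
  next
    case 4 then show ?thesis using bound[of "0.84"] l2 by (simp add: power2_eq_square)
  next
    case 5 then show ?thesis using bound[of "0.86"] l2 by (simp add: power2_eq_square)
  next
    case 6 then show ?thesis using bound[of "0.88"] l2 by (simp add: power2_eq_square)
  next
    case 7 then show ?thesis using bound[of "0.88"] l2 by (simp add: power2_eq_square)
  next
    case 8
    have "7.4 * 6 / (5 * real d) \<le> 7.4 * 6 / (5 * 11)" using 8 by (intro divide_left_mono) auto
    then show ?thesis using bound[of 1] l2 by simp
  qed
qed

section \<open>Exponential growth of \<open>q\<close>\<close>

lemma eventually_exp_le_q:
  fixes c :: real
  assumes "0 < a" "0 < d"
    and c: "c < sqrt (3 / (4 * real d)) * (2 + ln (5 * real d / 6))"
  shows "eventually (\<lambda>n. exp (c * sqrt (real n)) \<le> real (q d a n)) sequentially"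
proof -
  \<comment> \<open>About \<open>\<kappa> \<surd>n\<close> parts give the growth rate \<open>\<kappa> (2 + ln (1/\<kappa>\<^sup>2 - d/2))\<close>; the choice of \<open>\<kappa>\<close> is nearly
    optimal for \<open>d = 4\<close>, where the comparison with \<open>Q\<close> is tightest.\<close>
  define \<kappa> where "\<kappa> = sqrt (3 / (4 * real d))"
  have \<kappa>: "\<kappa> > 0" "\<kappa>\<^sup>2 = 3 / (4 * real d)"
    using assms by (auto simp: \<kappa>_def)
  \<comment> \<open>There are \<open>Suc (j n)\<close> parts, so \<open>j n\<close> is the exponent
    in \<open>power_le_q\<close>, and \<open>s n\<close> is the weight of the staircase. The scaled
    number of parts \<open>u\<close> tends to \<open>\<kappa>\<close>, and the fraction
    \<open>v\<close> of \<open>n\<close> left over tends to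
    \<open>1 - d * \<kappa>\<^sup>2 / 2 = 5 / 8\<close>.\<close>
  define j where "j = (\<lambda>n. nat \<lfloor>\<kappa> * sqrt (real n)\<rfloor>)"
  define s where "s = (\<lambda>n. a * Suc (j n) + d * (Suc (j n) * j n div 2))"
  define u where "u = (\<lambda>n. real (Suc (j n)) / sqrt (real n))"
  define v where "v = (\<lambda>n. (real n - real (s n)) / real n)"
  have u: "u \<longlonglongrightarrow> \<kappa>"
  proof (rule tendsto_sandwich)
    have "\<kappa> * sqrt (real n) \<le> real (Suc (j n)) \<and> real (Suc (j n)) \<le> \<kappa> * sqrt (real n) + 1" for n
    proof -
      have "real (j n) = of_int \<lfloor>\<kappa> * sqrt (real n)\<rfloor>"
        using \<kappa> by (simp add: j_def)
      then show ?thesis by (simp add: floor_correct) linarith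
    qed
    then have "\<kappa> \<le> u n \<and> u n \<le> \<kappa> + 1 / sqrt (real n)" if "n > 0" for n
      using that by (simp add: u_def pos_le_divide_eq pos_divide_le_eq distrib_right)
    then show "eventually (\<lambda>n. \<kappa> \<le> u n) sequentially"
      and "eventually (\<lambda>n. u n \<le> \<kappa> + 1 / sqrt (real n)) sequentially"
      by (auto intro: eventually_mono[OF eventually_gt_at_top[of 0]])
    show "(\<lambda>n. \<kappa> + 1 / sqrt (real n)) \<longlonglongrightarrow> \<kappa>" by real_asymp
  qed simp
  have v: "v \<longlonglongrightarrow> 5 / 8"
  proof (rule Lim_transform_eventually)
    have inv: "(\<lambda>n. 1 / sqrt (real n)) \<longlonglongrightarrow> 0" by real_asymp
    have "(\<lambda>n. 1 - real a * (u n * (1 / sqrt (real n)))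
        - real d / 2 * (u n * (u n - 1 / sqrt (real n))))
        \<longlonglongrightarrow> 1 - real a * (\<kappa> * 0) - real d / 2 * (\<kappa> * (\<kappa> - 0))"
      by (intro tendsto_intros u inv)
    also have "1 - real a * (\<kappa> * 0) - real d / 2 * (\<kappa> * (\<kappa> - 0)) = 5 / 8"
      using \<kappa>(2) assms by (simp add: power2_eq_square)
    finally show "(\<lambda>n. 1 - real a * (u n * (1 / sqrt (real n)))
        - real d / 2 * (u n * (u n - 1 / sqrt (real n)))) \<longlonglongrightarrow> 5 / 8" .
    show "eventually (\<lambda>n. 1 - real a * (u n * (1 / sqrt (real n)))
        - real d / 2 * (u n * (u n - 1 / sqrt (real n))) = v n) sequentially"
    proof (rule eventually_mono[OF eventually_gt_at_top[of 0]])
      fix n :: nat assume n: "n > 0"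
      have half: "real (Suc (j n) * j n div 2) = real (Suc (j n)) * real (j n) / 2"
        by (subst real_of_nat_div) (auto simp: algebra_simps)
      have s: "real (s n) = real a * real (Suc (j n))
          + real d * (real (Suc (j n)) * (real (Suc (j n)) - 1) / 2)"
        unfolding s_def of_nat_add of_nat_mult half by simp
      have ju: "real (Suc (j n)) = u n * sqrt (real n)"
        using n by (simp add: u_def)
      define w where "w = sqrt (real n)"
      have w: "real n = w * w" "w > 0" using n by (auto simp: w_def)
      show "1 - real a * (u n * (1 / sqrt (real n)))
          - real d / 2 * (u n * (u n - 1 / sqrt (real n))) = v n"
        unfolding v_def s ju w_def[symmetric] unfolding w(1)
        using w(2) by (simp add: field_simps)
    qed
  qed
  \<comment> \<open>\<open>F n * sqrt n\<close> is the lower bound for \<open>ln (q d a n)\<close>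
    obtained from \<open>power_le_q\<close> and \<open>ln_fact_le\<close>. The terms of order
    \<open>sqrt n * ln n\<close> from the power and from the squared factorial cancel, so
    \<open>F\<close> converges.\<close>
  define F where "F = (\<lambda>n. u n * (ln (v n) - 2 * ln (u n) + 2)
    - (ln (v n) + 2 * ln (u n) + 2) * (1 / sqrt (real n)) - 2 * (ln (real n) / sqrt (real n)))"
  have F: "F \<longlonglongrightarrow> \<kappa> * (2 + ln (5 * real d / 6))"
  proof -
    have inv: "(\<lambda>n. 1 / sqrt (real n)) \<longlonglongrightarrow> 0" "(\<lambda>n. ln (real n) / sqrt (real n)) \<longlonglongrightarrow> 0"
      by real_asymp+
    have "F \<longlonglongrightarrow> \<kappa> * (ln (5 / 8) - 2 * ln \<kappa> + 2) - (ln (5 / 8) + 2 * ln \<kappa> + 2) * 0 - 2 * 0"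
      unfolding F_def using \<kappa> by (intro tendsto_intros u v inv) auto
    \<comment> \<open>By the choice of \<open>\<kappa>\<close>,
      \<open>(5 / 8) / \<kappa>\<^sup>2 = 5 * d / 6\<close>.\<close>
    moreover have ln_eq: "ln (5 * real d / 6) = ln (5 / 8) - 2 * ln \<kappa>"
    proof -
      have "ln (5 * real d / 6) = ln (5 / 8) - ln (\<kappa>\<^sup>2)"
        using assms unfolding \<kappa>(2) by (simp add: field_simps flip: ln_divide_pos)
      then show ?thesis using \<kappa>(1) by (simp add: ln_realpow)
    qed
    ultimately show ?thesis unfolding ln_eq by (simp add: algebra_simps)
  qed
  have "eventually (\<lambda>n. F n > c) sequentially"
    using c by (intro order_tendstoD(1)[OF F]) (simp add: \<kappa>_def)
  moreover have "eventually (\<lambda>n. v n > 0) sequentially"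
    by (intro order_tendstoD(1)[OF v]) simp
  ultimately show ?thesis
    using eventually_gt_at_top[of 0]
  proof eventually_elim
    case (elim n)
    define w where "w = sqrt (real n)"
    have w: "w > 0" "ln (real n) = 2 * ln w"
      using elim by (auto simp: w_def ln_sqrt)
    define k where "k = Suc (j n)"
    define N where "N = n - s n"
    have s: "s n < n" using elim by (simp add: v_def zero_less_divide_iff)
    then have N: "N > 0" "real N = v n * real n"
      using elim by (auto simp: N_def v_def of_nat_diff)
    have k: "k > 0" "real k = u n * w" "u n > 0"
      using elim by (auto simp: k_def u_def w_def)
    have "N ^ j n \<le> q d a n * (fact k)\<^sup>2"
      using power_le_q[OF assms(1), of N "j n" d] s by (simp add: N_def s_def k_def del: fact_Suc)
    then have "real (N ^ j n) \<le> real (q d a n * (fact k)\<^sup>2)"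
      by (rule of_nat_mono)
    then have le: "real N ^ j n \<le> real (q d a n) * (fact k)\<^sup>2" by simp
    moreover have "real N ^ j n > 0" using N by simp
    ultimately have q: "real (q d a n) > 0" by (cases "q d a n = 0") auto
    have "ln (real N ^ j n) \<le> ln (real (q d a n) * (fact k)\<^sup>2)"
      using le N(1) q by (subst ln_le_cancel_iff) (auto intro!: mult_pos_pos)
    then have "real (j n) * ln (real N) \<le> ln (real (q d a n)) + 2 * ln (fact k)"
      using N q by (simp add: ln_realpow ln_mult)
    moreover have "real (j n) = u n * w - 1" using k by (simp add: k_def)
    moreover have "ln (real N) = ln (v n) + 2 * ln w"
      using N elim w by (simp add: ln_mult)
    moreover have "ln (fact k) \<le> real k * ln (real k) - real k + 1 + ln (real k)"
      using k(1) by (rule ln_fact_le)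
    moreover have "ln (real k) = ln (u n) + ln w"
      using k w by (simp add: ln_mult)
    ultimately have "(u n * w - 1) * (ln (v n) + 2 * ln w)
        \<le> ln (real (q d a n)) + 2 * (u n * w * (ln (u n) + ln w) - u n * w + 1 + (ln (u n) + ln w))"
      using k(2) by simp
    moreover have "F n * w = (u n * w - 1) * (ln (v n) + 2 * ln w)
        - 2 * (u n * w * (ln (u n) + ln w) - u n * w + 1 + (ln (u n) + ln w))"
      using w unfolding F_def w_def[symmetric] w(2) by (simp add: field_simps)
    ultimately have "F n * w \<le> ln (real (q d a n))" by simp
    moreover have "c * w \<le> F n * w" using elim w by (intro mult_right_mono) auto
    ultimately have "exp (c * w) \<le> exp (ln (real (q d a n)))" by simp
    then show ?case using q by (simp add: w_def)
  qed
qed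

section \<open>Comparison of the two exponents\<close>

text \<open>With \<open>m = d + 3\<close>, the choice \<open>t = pi / sqrt (3 * m * n)\<close> makes
  the two terms \<open>n * t\<close> and \<open>pi^2 / (3 * m * t)\<close> equal, which minimizes
  their sum.\<close>

lemma Q_minus_minus_le_exp_sqrt:
  assumes "0 < a" "a < d + 3" "n > 0"
  shows "real (Q_minus_minus d a n) \<le> exp (2 * pi / sqrt (3 * (real d + 3)) * sqrt (real n))"
proof -
  define M where "M = 3 * (real d + 3)"
  define w where "w = sqrt M"
  define z where "z = sqrt (real n)"
  have w: "w > 0" "M = w * w" by (auto simp: w_def M_def)
  have z: "z > 0" "real n = z * z" using assms by (auto simp: z_def)
  have "real (Q_minus_minus d a n)
      \<le> exp (real n * (pi / (w * z)) + pi\<^sup>2 / (3 * real (d + 3) * (pi / (w * z))))"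
    using w z by (intro Q_minus_minus_le assms) auto
  also have "3 * real (d + 3) = w * w" using w(2) by (simp add: M_def)
  also have "real n * (pi / (w * z)) + pi\<^sup>2 / (w * w * (pi / (w * z))) = 2 * pi / w * z"
    unfolding z(2) using w z by (simp add: field_simps power2_eq_square)
  finally show ?thesis by (simp add: w_def z_def M_def)
qed

theorem theorem1p8:
  fixes a d :: nat
  assumes "a \<ge> 1" and "d \<ge> 4"
    and "real a < (real d + 3) / 2"
    and "gcd a (d + 3) = 1"
  shows "filterlim (\<lambda>n. Delta_minus_minus d a n) at_top sequentially"
proof -
  define C where "C = 2 * pi / sqrt (3 * (real d + 3))"
  define c\<^sub>1 where "c\<^sub>1 = sqrt (3 / (4 * real d)) * (2 + ln (5 * real d / 6))"
  have "sqrt (3 / (4 * real d)) * (4 * pi / 3 * sqrt (real d / (real d + 3))) < c\<^sub>1"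
    unfolding c\<^sub>1_def using growth_constants_less[OF assms(2)] assms(2)
    by (intro mult_strict_left_mono) auto
  moreover have "sqrt (3 / (4 * real d)) * (4 * pi / 3 * sqrt (real d / (real d + 3))) = C"
    using assms(2) unfolding C_def real_sqrt_mult real_sqrt_divide
    by (simp add: field_simps)
  ultimately have "C < c\<^sub>1" by simp
  \<comment> \<open>The bound on \<open>q\<close> is available only for exponents strictly below
    \<open>c\<^sub>1\<close>, and the difference of exponentials diverges only if \<open>c\<close>
    exceeds \<open>C\<close>.\<close>
  then obtain c where c: "C < c" "c < c\<^sub>1" using dense by blast
  have C: "C > 0" by (simp add: C_def)
  have lim: "filterlim (\<lambda>n::nat. exp (c * sqrt (real n)) - exp (C * sqrt (real n))) at_top sequentially"
    using c(1) C by real_asymp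
  have "eventually (\<lambda>n. exp (c * sqrt (real n)) \<le> real (q d a n)) sequentially"
    using c(2) assms by (intro eventually_exp_le_q) (auto simp: c\<^sub>1_def)
  then have le: "eventually (\<lambda>n. exp (c * sqrt (real n)) - exp (C * sqrt (real n))
      \<le> real_of_int (Delta_minus_minus d a n)) sequentially"
    using eventually_gt_at_top[of 0]
  proof eventually_elim
    case (elim n)
    then show ?case
      using Q_minus_minus_le_exp_sqrt[of a d n] assms(1,3)
      by (simp add: Delta_minus_minus_def C_def)
  qed
  have "filterlim (\<lambda>n. real_of_int (Delta_minus_minus d a n)) at_top sequentially"
    by (rule filterlim_at_top_mono[OF lim le])
  then have "eventually (\<lambda>n. real_of_int Z \<le> real_of_int (Delta_minus_minus d a n)) sequentially" for Z
    unfolding filterlim_at_top by blast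
  then show ?thesis by (simp add: filterlim_at_top)
qed

end
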